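(* Let $(\Omega_i,\mathcal B_i,\mu_i)$, $i=1,2$, be two measure spaces and $T$ an index set. Consider two families of measurable functions $f_t^{(i)}:\Omega_i\to\mathbb R$, $t\in T$, $i=1,2$, and define two measurable mappings $F_i:(\Omega_i,\mathcal B_i)\to(\mathbb R^T,\mathcal B)$ by $F_i(\omega)=(f_t^{(i)}(\omega))_{t\in T}$, $\omega\in\Omega_i$, $i=1,2$, where $\mathcal B$ is the product $\sigma$-algebra on $\mathbb R^T$. Assume that 1. $\sigma\{f_t^{(i)},t\in T\}=\mathcal B_i$ mod $\mu_i$, $i=1,2$; 2. the induced measures $\mu_1\circ F_1^{-1}$ and $\mu_2\circ F_2^{-1}$ are equal on $(\mathbb R^T,\mathcal B)$. Then the following two claims are true: (i) If $(\Omega_1,\mathcal B_1)$ is a Borel space, then there exists a measurable map $\Phi:\Omega_2\to\Omega_1$ such that $\mu_1=\mu_2\circ\Phi^{-1}$ and for all $t\in T$, $f_t^{(2)}=f_t^{(1)}\circ\Phi$, $\mu_2$-a.e. (ii) If both $(\Omega_i,\mathcal B_i)$, $i=1,2$, are Borel spaces, then the mapping in part (i) is a measure space isomorphism and it is unique (modulo null sets).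
   Context: Equality of $\sigma$-algebras mod $\mu_i$ in assumption 1 means: for every $B\in\mathcal B_i$ there is $A\in\sigma\{f_t^{(i)},t\in T\}$ with $\mu_i(A\Delta B)=0$. A measurable space is a Borel space if it is isomorphic (via a bijection measurable in both directions) to a complete separable metric space with its Borel $\sigma$-algebra. A measure space isomorphism (modulo null sets) between $(\Omega,\mathcal A,\mu)$ and $(\Omega',\mathcal A',\mu')$ is a bijection $\Phi:\Omega\setminus A\to\Omega'\setminus A'$, with $A\in\mathcal A$, $A'\in\mathcal A'$ null sets, such that $\Phi,\Phi^{-1}$ are measurable and $\mu(E)=\mu'(\Phi(E))$ for all measurable $E\subset\Omega\setminus A$. Two isomorphisms are equal modulo null sets if they agree $\mu$-a.e. *)

theory Defs
  imports "HOL-Analysis.Analysis"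
begin

definition separable_metric :: "'a metric \<Rightarrow> bool" where
  "separable_metric Y \<longleftrightarrow>
     (\<exists>C. countable C \<and> C \<subseteq> mspace Y \<and> mtopology_of Y closure_of C = mspace Y)"

definition metric_borel :: "'a metric \<Rightarrow> 'a measure" where
  "metric_borel Y = sigma (mspace Y) {U. openin (mtopology_of Y) U}"

definition measurable_iso :: "'a measure \<Rightarrow> 'b measure \<Rightarrow> ('a \<Rightarrow> 'b) \<Rightarrow> bool" where
  "measurable_iso M N \<Phi> \<longleftrightarrow>
     bij_betw \<Phi> (space M) (space N) \<and>
     \<Phi> \<in> M \<rightarrow>\<^sub>M N \<and> the_inv_into (space M) \<Phi> \<in> N \<rightarrow>\<^sub>M M"

(* The metric space may be taken on a subset of the type of the points of M: every metric
   space in bijection with space M has an isometric copy there. Only the sigma-algebra of M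
   matters, since measurable_iso does not refer to the measure. *)
definition borel_space :: "'a measure \<Rightarrow> bool" where
  "borel_space M \<longleftrightarrow>
     (\<exists>(Y :: 'a metric) \<Phi>. mcomplete_of Y \<and> separable_metric Y \<and>
        measurable_iso M (metric_borel Y) \<Phi>)"

definition family_sigma :: "'a measure \<Rightarrow> 't set \<Rightarrow> ('t \<Rightarrow> 'a \<Rightarrow> real) \<Rightarrow> 'a set set" where
  "family_sigma M T f =
     sigma_sets (space M) {f t -` B \<inter> space M |t B. t \<in> T \<and> B \<in> sets borel}"

(* sigma{f_t, t in T} = sets M mod M; the other inclusion is automatic for measurable f_t *)
definition generates_mod_null :: "'a measure \<Rightarrow> 't set \<Rightarrow> ('t \<Rightarrow> 'a \<Rightarrow> real) \<Rightarrow> bool" where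
  "generates_mod_null M T f \<longleftrightarrow>
     (\<forall>B\<in>sets M. \<exists>A\<in>family_sigma M T f. emeasure M (sym_diff A B) = 0)"

definition joint_map :: "'t set \<Rightarrow> ('t \<Rightarrow> 'a \<Rightarrow> real) \<Rightarrow> 'a \<Rightarrow> 't \<Rightarrow> real" where
  "joint_map T f \<omega> = (\<lambda>t\<in>T. f t \<omega>)"

(* The partial bijection space M - A \<rightarrow> space N - A' is represented by a total function;
   its values on A are irrelevant. *)
definition iso_mod_null :: "'a measure \<Rightarrow> 'b measure \<Rightarrow> ('a \<Rightarrow> 'b) \<Rightarrow> bool" where
  "iso_mod_null M N \<Phi> \<longleftrightarrow>
     (\<exists>A\<in>null_sets M. \<exists>A'\<in>null_sets N.
        measurable_iso (restrict_space M (space M - A)) (restrict_space N (space N - A')) \<Phi> \<and>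
        (\<forall>E\<in>sets M. E \<subseteq> space M - A \<longrightarrow> emeasure M E = emeasure N (\<Phi> ` E)))"

definition intertwines ::
  "'t set \<Rightarrow> 'a measure \<Rightarrow> ('t \<Rightarrow> 'a \<Rightarrow> real) \<Rightarrow> ('t \<Rightarrow> 'b \<Rightarrow> real) \<Rightarrow> ('a \<Rightarrow> 'b) \<Rightarrow> bool" where
  "intertwines T M f g \<Phi> \<longleftrightarrow> (\<forall>t\<in>T. AE \<omega> in M. f t \<omega> = g t (\<Phi> \<omega>))"

end

theory Submission
  imports Defs
begin

text \<open>
  The joint map \<open>F1\<close> of the family \<open>f1\<close> has a measurable left inverse up to a null set. Indeed,
  carry the points of \<open>M1\<close> to a complete separable metric space. Every small ball there is, up to
  a null set, the preimage under \<open>F1\<close> of a set in the product space, and there are countably many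
  balls with centres in a dense sequence and radii \<open>1/(k+1)\<close>. So off a single null set the value
  \<open>F1 x\<close> decides which of these balls contain \<open>x\<close>, and \<open>x\<close> is the limit of the centres chosen
  in this way. Completeness makes the limit a measurable function \<open>G\<close> on the whole product space
  (\<open>Doob_Dynkin_mod_null\<close>, \<open>borel_space_left_inverse_mod_null\<close>).

  For part (i) put \<open>\<Phi> = G \<circ> F2\<close>. Both required properties are statements about the law of the
  joint map: the law of \<open>F2\<close> is carried by \<open>G\<close> to the same measure as the law of \<open>F1\<close>, which is
  \<open>M1\<close> because \<open>G \<circ> F1\<close> is almost everywhere the identity; and \<open>p t = f1 t (G p)\<close> holds for
  almost all \<open>p\<close> under the law of \<open>F1\<close>, hence under that of \<open>F2\<close>.

  Uniqueness is delicate for uncountable \<open>T\<close>, since the exceptional null set in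
  \<open>f2 t = f1 t \<circ> \<Phi>\<close> depends on \<open>t\<close>, so that \<open>F1 \<circ> \<Phi> = F2\<close> need not hold almost everywhere.
  One compares sets instead of points. If \<open>\<Phi>\<close> and \<open>\<Psi>\<close> both intertwine, then for each fixed set
  \<open>A\<close> generated by the family, \<open>\<Phi> \<omega> \<in> A\<close> and \<open>\<Psi> \<omega> \<in> A\<close> are equivalent for almost all \<open>\<omega>\<close>, by
  induction on \<open>A\<close>; as null sets pull back to null sets, this extends to every measurable set, and
  countably many measurable sets separate points (\<open>nonsingular_intertwiners_agree\<close>).

  For part (ii), part (i) with the roles exchanged gives a map \<open>\<Psi>\<close> from \<open>M1\<close> to \<open>M2\<close>. Both
  compositions of \<open>\<Phi>\<close> and \<open>\<Psi>\<close> intertwine a family with itself, as the identity does, so by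
  uniqueness they are the identity almost everywhere. Restricted to the points which the
  compositions fix, \<open>\<Phi>\<close> and \<open>\<Psi>\<close> are then inverse bijections (\<open>iso_mod_nullI\<close>).
\<close>

section \<open>Recovering a Polish-valued map from a map that generates mod null sets\<close>

lemma separable_metric_dense_sequence:
  assumes "separable_metric Y" "mspace Y \<noteq> {}"
  obtains y :: "nat \<Rightarrow> 'a"
  where "\<And>j. y j \<in> mspace Y"
    and "\<And>x e. x \<in> mspace Y \<Longrightarrow> e > 0 \<Longrightarrow> \<exists>j. mdist Y x (y j) < e"
proof -
  interpret Metric_space "mspace Y" "mdist Y" by (rule Metric_space_mspace_mdist)
  obtain C where C: "countable C" "C \<subseteq> mspace Y" "mtopology_of Y closure_of C = mspace Y"
    using assms(1) unfolding separable_metric_def by blast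
  have "C \<noteq> {}" using C(3) assms(2) by auto
  then have r: "range (from_nat_into C) = C" using C(1) by (rule range_from_nat_into)
  show thesis
  proof
    show "from_nat_into C j \<in> mspace Y" for j using r C(2) by blast
    fix x e assume x: "x \<in> mspace Y" "(e::real) > 0"
    then have "x \<in> mtopology closure_of C" using C(3) by (simp add: mtopology_of_def)
    then obtain c where c: "c \<in> C" "c \<in> mball x e"
      using x(2) unfolding metric_closure_of by blast
    then obtain j where "c = from_nat_into C j" using r by blast
    with c(2) show "\<exists>j. mdist Y x (from_nat_into C j) < e" by auto
  qed
qed

lemma sets_metric_borel_open:
  assumes "openin (mtopology_of Y) U" shows "U \<in> sets (metric_borel Y)"
proof -
  have "{U. openin (mtopology_of Y) U} \<subseteq> Pow (mspace Y)"
    using openin_subset[of "mtopology_of Y"] by auto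
  then show ?thesis using assms unfolding metric_borel_def by (simp add: sigma_sets.Basic)
qed

lemma space_metric_borel: "space (metric_borel Y) = mspace Y"
proof -
  have "{U. openin (mtopology_of Y) U} \<subseteq> Pow (mspace Y)"
    using openin_subset[of "mtopology_of Y"] by auto
  then show ?thesis unfolding metric_borel_def by (simp add: space_measure_of)
qed

lemma sets_Collect_mdist_less:
  assumes "\<phi> \<in> M \<rightarrow>\<^sub>M metric_borel Y" "a \<in> mspace Y"
  shows "{x \<in> space M. mdist Y (\<phi> x) a < r} \<in> sets M"
proof -
  interpret Metric_space "mspace Y" "mdist Y" by (rule Metric_space_mspace_mdist)
  have "mball a r \<in> sets (metric_borel Y)"
    by (rule sets_metric_borel_open) (simp add: mtopology_of_def)
  moreover have "{x \<in> space M. mdist Y (\<phi> x) a < r} = \<phi> -` mball a r \<inter> space M"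
    using measurable_space[OF assms(1)] assms(2) by (auto simp: space_metric_borel commute)
  ultimately show ?thesis using measurable_sets[OF assms(1)] by simp
qed

text \<open>
  An open set is the union of the balls contained in it that have a centre in the dense sequence and
  a radius \<open>1/(n+1)\<close>. There are countably many of them, so the distances to the centres
  determine measurability.
\<close>

lemma measurable_metric_borelI:
  assumes y: "\<And>j. y j \<in> mspace Y"
    and dense: "\<And>x e. x \<in> mspace Y \<Longrightarrow> e > 0 \<Longrightarrow> \<exists>j::nat. mdist Y x (y j) < e"
    and G: "\<And>p. p \<in> space P \<Longrightarrow> G p \<in> mspace Y"
    and dist: "\<And>j. (\<lambda>p. mdist Y (G p) (y j)) \<in> borel_measurable P"
  shows "G \<in> P \<rightarrow>\<^sub>M metric_borel Y"
  unfolding metric_borel_def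
proof (rule measurable_measure_of)
  interpret Metric_space "mspace Y" "mdist Y" by (rule Metric_space_mspace_mdist)
  show "{U. openin (mtopology_of Y) U} \<subseteq> Pow (mspace Y)"
    using openin_subset[of "mtopology_of Y"] by auto
  show "G \<in> space P \<rightarrow> mspace Y" using G by auto
  fix U assume "U \<in> {U. openin (mtopology_of Y) U}"
  then have U: "U \<subseteq> mspace Y" "\<And>x. x \<in> U \<Longrightarrow> \<exists>r>0. mball x r \<subseteq> U"
    by (auto simp: mtopology_of_def openin_mtopology)
  define I where "I = {(j, n::nat). mball (y j) (inverse (Suc n)) \<subseteq> U}"
  have cover: "\<exists>(j,n)\<in>I. mdist Y x (y j) < inverse (Suc n)" if x: "x \<in> U" for x
  proof -
    obtain r where r: "r > 0" "mball x r \<subseteq> U" using U(2)[OF x] by blast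
    obtain n where n: "inverse (Suc n) < r / 2"
      using reals_Archimedean[of "r/2"] r(1) by auto
    obtain j where j: "mdist Y x (y j) < inverse (Suc n)"
      using dense[of x "inverse (Suc n)"] x U(1) by auto
    have "mball (y j) (inverse (Suc n)) \<subseteq> mball x r"
    proof
      fix z assume z: "z \<in> mball (y j) (inverse (Suc n))"
      then have "mdist Y x z \<le> mdist Y x (y j) + mdist Y (y j) z"
        using x U(1) by (intro triangle) auto
      with z j n x U(1) show "z \<in> mball x r" by auto
    qed
    with r(2) j show ?thesis unfolding I_def by blast
  qed
  have "G -` U \<inter> space P = (\<Union>(j,n)\<in>I. {p \<in> space P. mdist Y (G p) (y j) < inverse (Suc n)})"
  proof (intro set_eqI iffI)
    fix p assume "p \<in> G -` U \<inter> space P"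
    then show "p \<in> (\<Union>(j,n)\<in>I. {p \<in> space P. mdist Y (G p) (y j) < inverse (Suc n)})"
      using cover[of "G p"] by blast
  next
    fix p assume "p \<in> (\<Union>(j,n)\<in>I. {p \<in> space P. mdist Y (G p) (y j) < inverse (Suc n)})"
    then obtain j n where jn: "mball (y j) (inverse (Suc n)) \<subseteq> U" "p \<in> space P"
      "mdist Y (G p) (y j) < inverse (Suc n)" unfolding I_def by blast
    then have "G p \<in> mball (y j) (inverse (Suc n))" using G y by (simp add: commute)
    with jn show "p \<in> G -` U \<inter> space P" by blast
  qed
  also have "\<dots> \<in> sets P"
    using dist by (intro sets.countable_UN') (auto intro!: countableI_type)
  finally show "G -` U \<inter> space P \<in> sets P" .
qed

text \<open>
  The \<open>k\<close>-th approximation takes the value \<open>y (J k p)\<close> at \<open>p\<close>. By completeness the points where the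
  approximations converge are those where they form a Cauchy sequence, a condition on countably many
  real-valued functions; there the distance from the limit to \<open>y j\<close> is a limit of measurable
  functions.
\<close>

lemma limit_of_countably_valued_maps_measurable:
  assumes complete: "mcomplete_of Y"
    and y: "\<And>j. y j \<in> mspace Y"
    and dense: "\<And>x e. x \<in> mspace Y \<Longrightarrow> e > 0 \<Longrightarrow> \<exists>j::nat. mdist Y x (y j) < e"
    and J [measurable]: "\<And>k. J k \<in> P \<rightarrow>\<^sub>M count_space UNIV"
  obtains G where "G \<in> P \<rightarrow>\<^sub>M metric_borel Y"
    and "\<And>p x. limitin (mtopology_of Y) (\<lambda>k::nat. y (J k p)) x sequentially \<Longrightarrow> G p = x"
proof -
  interpret Metric_space "mspace Y" "mdist Y" by (rule Metric_space_mspace_mdist)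
  define Q where "Q p \<longleftrightarrow>
    (\<forall>m::nat. \<exists>N. \<forall>k\<ge>N. \<forall>l\<ge>N. mdist Y (y (J k p)) (y (J l p)) < inverse (Suc m))" for p
  \<comment> \<open>The constant value \<open>y 0\<close> off the set of convergence keeps \<open>G\<close> total and inside \<open>mspace Y\<close>.\<close>
  define G where "G p = (if Q p then (SOME x. limitin mtopology (\<lambda>k. y (J k p)) x sequentially)
    else y 0)" for p
  have Q_iff: "Q p \<longleftrightarrow> MCauchy (\<lambda>k. y (J k p))" for p
  proof
    assume Q: "Q p"
    show "MCauchy (\<lambda>k. y (J k p))" unfolding MCauchy_def
    proof (intro conjI allI impI)
      show "range (\<lambda>k. y (J k p)) \<subseteq> mspace Y" using y by auto
      fix e :: real assume "e > 0"
      then obtain m where "inverse (Suc m) < e" using reals_Archimedean by blast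
      with Q show "\<exists>N. \<forall>n n'. N \<le> n \<longrightarrow> N \<le> n' \<longrightarrow> mdist Y (y (J n p)) (y (J n' p)) < e"
        unfolding Q_def by (meson order_less_trans)
    qed
  next
    assume "MCauchy (\<lambda>k. y (J k p))"
    then have "\<exists>N. \<forall>n n'. N \<le> n \<longrightarrow> N \<le> n' \<longrightarrow> mdist Y (y (J n p)) (y (J n' p)) < e" if "e > 0" for e
      using that unfolding MCauchy_def by blast
    then show "Q p" unfolding Q_def by simp
  qed
  have G_lim: "limitin mtopology (\<lambda>k. y (J k p)) (G p) sequentially" if "Q p" for p
  proof -
    have "\<exists>x. limitin mtopology (\<lambda>k. y (J k p)) x sequentially"
      using that complete unfolding Q_iff mcomplete_of_def mcomplete_def by blast
    from someI_ex[OF this] that show ?thesis by (simp add: G_def)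
  qed
  have G_space: "G p \<in> mspace Y" for p
    using G_lim[of p] y[of 0] by (cases "Q p") (auto simp: G_def limitin_mspace)
  have dist_lim: "mdist Y (G p) (y j) = lim (\<lambda>k. mdist Y (y (J k p)) (y j))" if "Q p" for p j
  proof -
    have "(\<lambda>k. mdist Y (y (J k p)) (G p)) \<longlonglongrightarrow> 0"
      using G_lim[OF that] by (simp add: limitin_metric_dist_null)
    moreover have "\<forall>k. norm (mdist Y (y (J k p)) (y j) - mdist Y (G p) (y j))
      \<le> mdist Y (y (J k p)) (G p)"
    proof
      fix k
      show "norm (mdist Y (y (J k p)) (y j) - mdist Y (G p) (y j)) \<le> mdist Y (y (J k p)) (G p)"
        using triangle[of "y (J k p)" "G p" "y j"] triangle[of "G p" "y (J k p)" "y j"]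
          y G_space[of p] commute[of "G p" "y (J k p)"] by (simp add: abs_le_iff)
    qed
    ultimately have "(\<lambda>k. mdist Y (y (J k p)) (y j) - mdist Y (G p) (y j)) \<longlonglongrightarrow> 0"
      by (rule Lim_null_comparison[OF always_eventually, rotated])
    then have "(\<lambda>k. mdist Y (y (J k p)) (y j)) \<longlonglongrightarrow> mdist Y (G p) (y j)"
      by (simp add: LIM_zero_iff)
    then show ?thesis by (simp add: limI)
  qed
  have J_comp: "(\<lambda>p. h (J k p)) \<in> borel_measurable P" for h :: "nat \<Rightarrow> real" and k
    by measurable
  have J_comp2 [measurable]: "(\<lambda>p. mdist Y (y (J k p)) (y (J l p))) \<in> borel_measurable P" for k l
    by (rule measurable_compose_countable[OF _ J[of l]]) (rule J_comp)
  have [measurable]: "Measurable.pred P Q" unfolding Q_def[abs_def] by measurable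
  have dist_meas: "(\<lambda>p. mdist Y (G p) (y j)) \<in> borel_measurable P" for j
  proof -
    have "(\<lambda>p. mdist Y (G p) (y j)) =
      (\<lambda>p. if Q p then lim (\<lambda>k. mdist Y (y (J k p)) (y j)) else mdist Y (y 0) (y j))"
      using dist_lim by (auto simp: G_def)
    also have "\<dots> \<in> borel_measurable P"
      by (intro measurable_If borel_measurable_lim_metric J_comp) measurable
    finally show ?thesis .
  qed
  show thesis
  proof
    show "G \<in> P \<rightarrow>\<^sub>M metric_borel Y"
      using measurable_metric_borelI[OF y dense G_space dist_meas] .
    fix p x assume "limitin (mtopology_of Y) (\<lambda>k. y (J k p)) x sequentially"
    then have l: "limitin mtopology (\<lambda>k. y (J k p)) x sequentially" by (simp add: mtopology_of_def)
    then have "Q p" unfolding Q_iff using y by (intro convergent_imp_MCauchy) auto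
    from limitin_metric_unique[OF G_lim[OF this] l] show "G p = x" by simp
  qed
qed

text \<open>
  A version of the Doob-Dynkin factorisation lemma: if every measurable set is, up to a null set, a
  preimage under \<open>F\<close>, then every measurable map to a Polish space is, up to a null set, a function
  of \<open>F\<close>. The values of \<open>\<phi>\<close> are approximated within \<open>1/(k+1)\<close> by the first point of a dense
  sequence that is this close to them. This choice is made by testing membership in countably many
  sets, which can be replaced by preimages under \<open>F\<close> at the cost of a null set.
\<close>

lemma Doob_Dynkin_mod_null:
  assumes Y: "mcomplete_of Y" "separable_metric Y" "mspace Y \<noteq> {}"
    and \<phi>: "\<phi> \<in> M \<rightarrow>\<^sub>M metric_borel Y"
    and F: "F \<in> M \<rightarrow>\<^sub>M P"
    and gen: "\<And>B. B \<in> sets M \<Longrightarrow>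
      \<exists>C\<in>sets P. emeasure M (sym_diff (F -` C \<inter> space M) B) = 0"
  obtains G where "G \<in> P \<rightarrow>\<^sub>M metric_borel Y" "AE x in M. G (F x) = \<phi> x"
proof -
  interpret Metric_space "mspace Y" "mdist Y" by (rule Metric_space_mspace_mdist)
  obtain y where y: "\<And>j. y j \<in> mspace Y"
    and dense: "\<And>x e. x \<in> mspace Y \<Longrightarrow> e > 0 \<Longrightarrow> \<exists>j::nat. mdist Y x (y j) < e"
    using separable_metric_dense_sequence[OF Y(2,3)] by metis
  define B where "B k j = {x \<in> space M. mdist Y (\<phi> x) (y j) < inverse (Suc k)}" for k j :: nat
  have B: "B k j \<in> sets M" for k j
    unfolding B_def by (rule sets_Collect_mdist_less[OF \<phi> y])
  obtain C where C: "C k j \<in> sets P" "emeasure M (sym_diff (F -` C k j \<inter> space M) (B k j)) = 0"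
    for k j using gen[OF B] by metis
  define J where "J k p = (LEAST j. p \<in> C k j)" for k p
  have "J k \<in> P \<rightarrow>\<^sub>M count_space UNIV" for k
    unfolding J_def using C(1) by (intro measurable_Least) (simp add: pred_def sets.Int_space_eq2)
  then obtain G where G: "G \<in> P \<rightarrow>\<^sub>M metric_borel Y"
    "\<And>p x. limitin (mtopology_of Y) (\<lambda>k. y (J k p)) x sequentially \<Longrightarrow> G p = x"
    using limit_of_countably_valued_maps_measurable[where y=y and J=J and P=P, OF Y(1) y dense] by metis
  \<comment> \<open>Off one null set, \<open>F x \<in> C k j\<close> tells exactly whether \<open>\<phi> x\<close> is within \<open>1/(k+1)\<close> of \<open>y j\<close>.\<close>
  have "AE x in M. \<forall>k j. x \<notin> sym_diff (F -` C k j \<inter> space M) (B k j)"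
    using C B F by (intro AE_all_countable[THEN iffD2] allI AE_not_in null_setsI) auto
  then have "AE x in M. G (F x) = \<phi> x"
  proof (rule AE_mp, intro AE_I2 impI)
    fix x assume x: "x \<in> space M" and "\<forall>k j. x \<notin> sym_diff (F -` C k j \<inter> space M) (B k j)"
    then have eq: "F x \<in> C k j \<longleftrightarrow> mdist Y (\<phi> x) (y j) < inverse (Suc k)" for k j
      unfolding B_def by blast
    have \<phi>x: "\<phi> x \<in> mspace Y" using measurable_space[OF \<phi> x] by (simp add: space_metric_borel)
    have close: "mdist Y (\<phi> x) (y (J k (F x))) < inverse (Suc k)" for k
    proof -
      obtain j where "mdist Y (\<phi> x) (y j) < inverse (Suc k)"
        using dense[OF \<phi>x, of "inverse (Suc k)"] by auto
      then have "F x \<in> C k j" by (simp add: eq)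
      then have "F x \<in> C k (J k (F x))" unfolding J_def by (rule LeastI)
      then show ?thesis by (simp add: eq)
    qed
    have "(\<lambda>k. mdist Y (y (J k (F x))) (\<phi> x)) \<longlonglongrightarrow> 0"
      by (rule Lim_null_comparison[OF always_eventually LIMSEQ_inverse_real_of_nat])
        (use close in \<open>auto simp: commute intro: less_imp_le\<close>)
    then have "limitin mtopology (\<lambda>k. y (J k (F x))) (\<phi> x) sequentially"
      using y \<phi>x by (simp add: limitin_metric_dist_null)
    then show "G (F x) = \<phi> x" by (intro G(2)) (simp add: mtopology_of_def)
  qed
  with G(1) show thesis by (rule that)
qed

lemma borel_space_left_inverse_mod_null:
  fixes M :: "'a measure"
  assumes M: "borel_space M" "space M \<noteq> {}"
    and F: "F \<in> M \<rightarrow>\<^sub>M P"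
    and gen: "\<And>B. B \<in> sets M \<Longrightarrow>
      \<exists>C\<in>sets P. emeasure M (sym_diff (F -` C \<inter> space M) B) = 0"
  obtains G where "G \<in> P \<rightarrow>\<^sub>M M" "AE x in M. G (F x) = x"
proof -
  obtain Y :: "'a metric" and \<phi> where Y: "mcomplete_of Y" "separable_metric Y"
    and iso: "measurable_iso M (metric_borel Y) \<phi>"
    using M(1) unfolding borel_space_def by blast
  then have \<phi>: "bij_betw \<phi> (space M) (mspace Y)" "\<phi> \<in> M \<rightarrow>\<^sub>M metric_borel Y"
    and inv: "the_inv_into (space M) \<phi> \<in> metric_borel Y \<rightarrow>\<^sub>M M"
    unfolding measurable_iso_def by (auto simp: space_metric_borel)
  have "mspace Y \<noteq> {}" using \<phi>(1) M(2) by (auto simp: bij_betw_def)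
  from Doob_Dynkin_mod_null[OF Y this \<phi>(2) F gen]
  obtain G where G: "G \<in> P \<rightarrow>\<^sub>M metric_borel Y" "AE x in M. G (F x) = \<phi> x" by metis
  show thesis
  proof
    show "(\<lambda>p. the_inv_into (space M) \<phi> (G p)) \<in> P \<rightarrow>\<^sub>M M"
      using G(1) inv by (rule measurable_compose)
    show "AE x in M. the_inv_into (space M) \<phi> (G (F x)) = x"
      using G(2) AE_space
      by eventually_elim (use \<phi>(1) in \<open>simp add: bij_betw_def the_inv_into_f_f\<close>)
  qed
qed

section \<open>Existence of an intertwining map\<close>

lemma measurable_joint_map:
  assumes "\<And>t. t \<in> T \<Longrightarrow> f t \<in> borel_measurable M"
  shows "joint_map T f \<in> M \<rightarrow>\<^sub>M (\<Pi>\<^sub>M t\<in>T. borel)"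
  using assms unfolding joint_map_def[abs_def] by (intro measurable_restrict) auto

lemma family_sigma_subset_joint_map_vimages:
  assumes "A \<in> family_sigma M T f"
  shows "\<exists>C\<in>sets (\<Pi>\<^sub>M t\<in>T. borel). A = joint_map T f -` C \<inter> space M"
  using assms unfolding family_sigma_def
proof induction
  let ?P = "\<Pi>\<^sub>M t\<in>T. (borel :: real measure)"
  have sp: "joint_map T f \<omega> \<in> space ?P" for \<omega>
    by (auto simp: joint_map_def space_PiM)
  {
    case (Basic A)
    then obtain t B where tB: "t \<in> T" "B \<in> sets borel" "A = f t -` B \<inter> space M" by blast
    then have "{x \<in> space ?P. x t \<in> B} \<in> sets ?P" by measurable
    moreover have "A = joint_map T f -` {x \<in> space ?P. x t \<in> B} \<inter> space M"
      using tB sp by (auto simp: joint_map_def)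
    ultimately show ?case by blast
  next
    case Empty
    then show ?case by (intro bexI[of _ "{}"]) auto
  next
    case (Compl A)
    then obtain C where "C \<in> sets ?P" "A = joint_map T f -` C \<inter> space M" by blast
    then show ?case using sp by (intro bexI[of _ "space ?P - C"]) auto
  next
    case (Union A)
    then obtain C where "\<And>i::nat. C i \<in> sets ?P" "\<And>i. A i = joint_map T f -` C i \<inter> space M"
      by metis
    then show ?case by (intro bexI[of _ "\<Union>i. C i"]) auto
  }
qed

text \<open>
  With \<open>G\<close> a left inverse mod null sets of the joint map of \<open>g\<close>, the map is \<open>G\<close> composed with the
  joint map of \<open>f\<close>. What has to be checked holds for the joint map of \<open>g\<close> by the choice of \<open>G\<close>,
  and it transfers because it depends only on the common law.
\<close>

lemma borel_space_intertwiner_exists: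
  fixes M :: "'a measure" and N :: "'b measure"
  assumes f: "\<And>t. t \<in> T \<Longrightarrow> f t \<in> borel_measurable M"
    and g: "\<And>t. t \<in> T \<Longrightarrow> g t \<in> borel_measurable N"
    and gen: "generates_mod_null N T g"
    and law: "distr N (\<Pi>\<^sub>M t\<in>T. borel) (joint_map T g) =
              distr M (\<Pi>\<^sub>M t\<in>T. borel) (joint_map T f)"
    and ne: "space N \<noteq> {}"
    and N: "borel_space N"
  obtains \<Phi> where "\<Phi> \<in> M \<rightarrow>\<^sub>M N" "N = distr M N \<Phi>" "intertwines T M f g \<Phi>"
proof -
  let ?P = "\<Pi>\<^sub>M t\<in>T. (borel :: real measure)"
  note F [measurable] = measurable_joint_map[where T=T and f=g and M=N, OF g]
    measurable_joint_map[where T=T and f=f and M=M, OF f]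
  have "\<exists>C\<in>sets ?P. emeasure N (sym_diff (joint_map T g -` C \<inter> space N) B) = 0"
    if "B \<in> sets N" for B
    using gen that family_sigma_subset_joint_map_vimages unfolding generates_mod_null_def by metis
  from borel_space_left_inverse_mod_null[OF N ne F(1) this]
  obtain G where G [measurable]: "G \<in> ?P \<rightarrow>\<^sub>M N"
    and GF: "AE x in N. G (joint_map T g x) = x" by metis
  show thesis
  proof
    show meas: "(\<lambda>\<omega>. G (joint_map T f \<omega>)) \<in> M \<rightarrow>\<^sub>M N" by measurable
    have "distr M N (\<lambda>\<omega>. G (joint_map T f \<omega>)) = distr (distr M ?P (joint_map T f)) N G"
      by (simp add: distr_distr comp_def)
    also have "\<dots> = distr (distr N ?P (joint_map T g)) N G" by (simp add: law)
    also have "\<dots> = distr N N (\<lambda>\<omega>. G (joint_map T g \<omega>))"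
      by (simp add: distr_distr comp_def)
    also have "\<dots> = distr N N (\<lambda>\<omega>. \<omega>)"
      by (rule distr_cong_AE) (use GF in auto)
    also have "\<dots> = N" by simp
    finally show "N = distr M N (\<lambda>\<omega>. G (joint_map T f \<omega>))" by simp
    show "intertwines T M f g (\<lambda>\<omega>. G (joint_map T f \<omega>))" unfolding intertwines_def
    proof
      fix t assume t: "t \<in> T"
      have [measurable]: "g t \<in> borel_measurable N" by (rule g[OF t])
      have set: "{p \<in> space ?P. p t = g t (G p)} \<in> sets ?P" using t by measurable
      have "AE \<omega> in N. joint_map T g \<omega> t = g t (G (joint_map T g \<omega>))"
        using GF by eventually_elim (use t in \<open>simp add: joint_map_def\<close>)
      then have "AE p in distr N ?P (joint_map T g). p t = g t (G p)"
        using set by (subst AE_distr_iff) auto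
      then have "AE \<omega> in M. joint_map T f \<omega> t = g t (G (joint_map T f \<omega>))"
        unfolding law using set by (subst (asm) AE_distr_iff) auto
      then show "AE \<omega> in M. f t \<omega> = g t (G (joint_map T f \<omega>))"
        using t by (simp add: joint_map_def)
    qed
  qed
qed

section \<open>Uniqueness of intertwining maps\<close>

text \<open>
  The two kinds of competitors in the uniqueness statement, measurable maps that preserve the measure
  and isomorphisms mod null sets, share this property. Measurability is not part of it, since an
  isomorphism mod null sets is arbitrary on a null set.
\<close>

definition nonsingular_map :: "'a measure \<Rightarrow> 'b measure \<Rightarrow> ('a \<Rightarrow> 'b) \<Rightarrow> bool" where
  "nonsingular_map M N \<Phi> \<longleftrightarrow>
     (AE \<omega> in M. \<Phi> \<omega> \<in> space N) \<and> (\<forall>Z\<in>null_sets N. AE \<omega> in M. \<Phi> \<omega> \<notin> Z)"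

definition countably_separated :: "'a measure \<Rightarrow> bool" where
  "countably_separated M \<longleftrightarrow> (\<exists>D :: nat \<Rightarrow> 'a set. (\<forall>n. D n \<in> sets M) \<and>
     (\<forall>x\<in>space M. \<forall>x'\<in>space M. (\<forall>n. x \<in> D n \<longleftrightarrow> x' \<in> D n) \<longrightarrow> x = x'))"

lemma nonsingular_map_AE:
  assumes "nonsingular_map M N \<Phi>" "AE x in N. P x"
  shows "AE \<omega> in M. P (\<Phi> \<omega>)"
proof -
  obtain Z where Z: "Z \<in> null_sets N" "{x \<in> space N. \<not> P x} \<subseteq> Z"
    using assms(2) by (auto simp: eventually_ae_filter)
  have "AE \<omega> in M. \<Phi> \<omega> \<in> space N" "AE \<omega> in M. \<Phi> \<omega> \<notin> Z"
    using assms(1) Z(1) by (auto simp: nonsingular_map_def)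
  then show ?thesis by eventually_elim (use Z(2) in auto)
qed

lemma nonsingular_map_id: "nonsingular_map M M (\<lambda>\<omega>. \<omega>)"
  by (auto simp: nonsingular_map_def AE_not_in)

lemma nonsingular_map_comp:
  assumes "nonsingular_map L M \<alpha>" "nonsingular_map M N \<beta>"
  shows "nonsingular_map L N (\<lambda>\<omega>. \<beta> (\<alpha> \<omega>))"
  using nonsingular_map_AE[OF assms(1)] assms(2) by (auto simp: nonsingular_map_def)

lemma intertwines_id: "intertwines T M f f (\<lambda>\<omega>. \<omega>)"
  by (simp add: intertwines_def)

lemma intertwines_comp:
  assumes "nonsingular_map L M \<alpha>" "intertwines T L f g \<alpha>" "intertwines T M g h \<beta>"
  shows "intertwines T L f h (\<lambda>\<omega>. \<beta> (\<alpha> \<omega>))"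
  unfolding intertwines_def
proof
  fix t assume t: "t \<in> T"
  have "AE \<omega> in L. f t \<omega> = g t (\<alpha> \<omega>)"
    using assms(2) t by (simp add: intertwines_def)
  moreover have "AE \<omega> in L. g t (\<alpha> \<omega>) = h t (\<beta> (\<alpha> \<omega>))"
    using assms(3) t by (intro nonsingular_map_AE[OF assms(1)]) (simp add: intertwines_def)
  ultimately show "AE \<omega> in L. f t \<omega> = h t (\<beta> (\<alpha> \<omega>))" by eventually_elim simp
qed

lemma nonsingular_map_distr:
  assumes "\<Phi> \<in> M \<rightarrow>\<^sub>M N" "N = distr M N \<Phi>"
  shows "nonsingular_map M N \<Phi>"
  unfolding nonsingular_map_def
proof (intro conjI ballI)
  show "AE \<omega> in M. \<Phi> \<omega> \<in> space N" using measurable_space[OF assms(1)] by auto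
  fix Z assume "Z \<in> null_sets N"
  then have "AE x in distr M N \<Phi>. x \<notin> Z" using assms(2) AE_not_in by metis
  with assms(1) show "AE \<omega> in M. \<Phi> \<omega> \<notin> Z" by (rule AE_distrD)
qed

text \<open>
  The part of \<open>Z\<close> that the isomorphism reaches has as its preimage a set \<open>E\<close> in the domain of the
  bijection, and \<open>E\<close> has the measure of its image, which lies in \<open>Z\<close>.
\<close>

lemma nonsingular_map_iso_mod_null:
  assumes "iso_mod_null M N \<Psi>"
  shows "nonsingular_map M N \<Psi>"
proof -
  obtain A A' where A: "A \<in> null_sets M" "A' \<in> null_sets N"
    and iso: "measurable_iso (restrict_space M (space M - A)) (restrict_space N (space N - A')) \<Psi>"
    and pres: "\<And>E. E \<in> sets M \<Longrightarrow> E \<subseteq> space M - A \<Longrightarrow> emeasure M E = emeasure N (\<Psi> ` E)"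
    using assms unfolding iso_mod_null_def by blast
  have bij: "bij_betw \<Psi> (space M - A) (space N - A')"
    and meas: "\<Psi> \<in> restrict_space M (space M - A) \<rightarrow>\<^sub>M restrict_space N (space N - A')"
    using iso by (auto simp: measurable_iso_def space_restrict_space Int_absorb2)
  have nA: "AE \<omega> in M. \<omega> \<notin> A" by (rule AE_not_in[OF A(1)])
  have AE_space_N: "AE \<omega> in M. \<Psi> \<omega> \<in> space N"
    using nA AE_space by eventually_elim (use bij in \<open>auto simp: bij_betw_def\<close>)
  moreover have "AE \<omega> in M. \<Psi> \<omega> \<notin> Z" if Z: "Z \<in> null_sets N" for Z
  proof -
    define E where "E = \<Psi> -` (Z - A') \<inter> (space M - A)"
    have "(space N - A') \<inter> Z \<in> sets (restrict_space N (space N - A'))"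
      using Z A by (intro sets_restrict_space_iff[THEN iffD2]) auto
    from measurable_sets[OF meas this]
    have "\<Psi> -` ((space N - A') \<inter> Z) \<inter> (space M - A) \<in> sets (restrict_space M (space M - A))"
      by (simp add: space_restrict_space Int_absorb2)
    moreover have "\<Psi> -` ((space N - A') \<inter> Z) \<inter> (space M - A) = E"
      using Z sets.sets_into_space[of Z N] by (auto simp: E_def)
    ultimately have E: "E \<in> sets M"
      using A(1) by (subst (asm) sets_restrict_space_iff) auto
    have "\<Psi> ` E \<subseteq> Z" by (auto simp: E_def)
    then have "emeasure N (\<Psi> ` E) = 0"
      using Z by (metis emeasure_mono le_zero_eq null_setsD1 null_setsD2)
    then have "E \<in> null_sets M" using E pres[OF E] by (auto simp: E_def)
    then have "AE \<omega> in M. \<omega> \<notin> E" by (rule AE_not_in)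
    with nA AE_space show ?thesis
      by eventually_elim (use bij in \<open>auto simp: E_def bij_betw_def\<close>)
  qed
  ultimately show ?thesis by (simp add: nonsingular_map_def)
qed

text \<open>
  The balls around a dense sequence with radii \<open>1/(k+1)\<close> separate points: two points lying in the
  same balls are both arbitrarily close to a common centre.
\<close>

lemma borel_space_countably_separated:
  fixes M :: "'a measure"
  assumes "borel_space M" shows "countably_separated M"
proof (cases "space M = {}")
  case True
  then show ?thesis unfolding countably_separated_def by (intro exI[of _ "\<lambda>_. {}"]) auto
next
  case False
  obtain Y :: "'a metric" and \<phi> where Y: "separable_metric Y" and iso: "measurable_iso M (metric_borel Y) \<phi>"
    using assms unfolding borel_space_def by blast
  interpret Metric_space "mspace Y" "mdist Y" by (rule Metric_space_mspace_mdist)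
  have \<phi>: "bij_betw \<phi> (space M) (mspace Y)" "\<phi> \<in> M \<rightarrow>\<^sub>M metric_borel Y"
    using iso unfolding measurable_iso_def by (auto simp: space_metric_borel)
  have "mspace Y \<noteq> {}" using \<phi>(1) False by (auto simp: bij_betw_def)
  then obtain y where y: "\<And>j. y j \<in> mspace Y"
    and dense: "\<And>x e. x \<in> mspace Y \<Longrightarrow> e > 0 \<Longrightarrow> \<exists>j::nat. mdist Y x (y j) < e"
    using separable_metric_dense_sequence[OF Y] by metis
  define D where "D n = (case prod_decode n of (j, k) \<Rightarrow>
    {x \<in> space M. mdist Y (\<phi> x) (y j) < inverse (Suc k)})" for n
  have "D n \<in> sets M" for n
    unfolding D_def by (auto split: prod.split intro: sets_Collect_mdist_less[OF \<phi>(2) y])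
  moreover have "x = x'" if x: "x \<in> space M" "x' \<in> space M" and eq: "\<forall>n. x \<in> D n \<longleftrightarrow> x' \<in> D n" for x x'
  proof -
    have \<phi>x: "\<phi> x \<in> mspace Y" "\<phi> x' \<in> mspace Y" using \<phi>(1) x by (auto simp: bij_betw_def)
    have "mdist Y (\<phi> x) (\<phi> x') \<le> 0"
    proof (rule field_le_epsilon)
      fix e :: real assume "e > 0"
      then obtain k where k: "inverse (Suc k) < e / 2" using reals_Archimedean[of "e/2"] by auto
      obtain j where j: "mdist Y (\<phi> x) (y j) < inverse (Suc k)"
        using dense[OF \<phi>x(1), of "inverse (Suc k)"] by auto
      then have "x \<in> D (prod_encode (j, k))" using x by (simp add: D_def)
      then have "x' \<in> D (prod_encode (j, k))" using eq by blast
      then have "mdist Y (\<phi> x') (y j) < inverse (Suc k)" by (simp add: D_def)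
      with j k show "mdist Y (\<phi> x) (\<phi> x') \<le> 0 + e"
        using triangle[OF \<phi>x(1) y \<phi>x(2), of j] commute[of "y j" "\<phi> x'"] by simp
    qed
    then have "\<phi> x = \<phi> x'" using \<phi>x nonneg[of "\<phi> x" "\<phi> x'"] by simp
    with \<phi>(1) x show ?thesis by (auto simp: bij_betw_def inj_on_def)
  qed
  ultimately show ?thesis unfolding countably_separated_def by blast
qed

lemma sets_Collect_eq_countably_separated:
  assumes "countably_separated N" "\<Phi> \<in> M \<rightarrow>\<^sub>M N" "\<Psi> \<in> M \<rightarrow>\<^sub>M N"
  shows "{x \<in> space M. \<Phi> x = \<Psi> x} \<in> sets M"
proof -
  obtain D :: "nat \<Rightarrow> _" where D [measurable]: "\<And>n. D n \<in> sets N"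
    and sep: "\<And>x x'. x \<in> space N \<Longrightarrow> x' \<in> space N \<Longrightarrow> \<forall>n. x \<in> D n \<longleftrightarrow> x' \<in> D n \<Longrightarrow> x = x'"
    using assms(1) unfolding countably_separated_def by metis
  note [measurable] = assms(2,3)
  have "{x \<in> space M. \<forall>n. \<Phi> x \<in> D n \<longleftrightarrow> \<Psi> x \<in> D n} \<in> sets M" by measurable
  moreover have "{x \<in> space M. \<forall>n. \<Phi> x \<in> D n \<longleftrightarrow> \<Psi> x \<in> D n} = {x \<in> space M. \<Phi> x = \<Psi> x}"
    using sep measurable_space[OF assms(2)] measurable_space[OF assms(3)] by auto
  ultimately show ?thesis by simp
qed

lemma family_sigma_sets:
  assumes "\<And>t. t \<in> T \<Longrightarrow> g t \<in> borel_measurable N"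
  shows "family_sigma N T g \<subseteq> sets N"
  unfolding family_sigma_def
  by (rule sets.sigma_sets_subset) (auto intro: measurable_sets assms)

text \<open>
  For each single \<open>t\<close> the functions \<open>g t \<circ> \<Phi>\<close> and \<open>g t \<circ> \<Psi>\<close> agree almost everywhere, with an
  exceptional set that may depend on \<open>t\<close>. Membership in one generated set involves only countably
  many of these null sets, which is why the induction is on sets; the passage from sets to points
  needs only a countable separating sequence.
\<close>

lemma nonsingular_intertwiners_agree:
  assumes g: "\<And>t. t \<in> T \<Longrightarrow> g t \<in> borel_measurable N"
    and gen: "generates_mod_null N T g"
    and sep: "countably_separated N"
    and \<Phi>: "nonsingular_map M N \<Phi>" "intertwines T M f g \<Phi>"
    and \<Psi>: "nonsingular_map M N \<Psi>" "intertwines T M f g \<Psi>"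
  shows "AE \<omega> in M. \<Phi> \<omega> = \<Psi> \<omega>"
proof -
  have sp: "AE \<omega> in M. \<Phi> \<omega> \<in> space N" "AE \<omega> in M. \<Psi> \<omega> \<in> space N"
    using \<Phi>(1) \<Psi>(1) by (auto simp: nonsingular_map_def)
  have family: "AE \<omega> in M. \<Phi> \<omega> \<in> A \<longleftrightarrow> \<Psi> \<omega> \<in> A" if "A \<in> family_sigma N T g" for A
    using that unfolding family_sigma_def
  proof induction
    case (Basic A)
    then obtain t B where t: "t \<in> T" and A: "A = g t -` B \<inter> space N" by blast
    have "AE \<omega> in M. f t \<omega> = g t (\<Phi> \<omega>)" "AE \<omega> in M. f t \<omega> = g t (\<Psi> \<omega>)"
      using \<Phi>(2) \<Psi>(2) t by (auto simp: intertwines_def)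
    with sp show ?case by eventually_elim (simp add: A)
  next
    case (Compl A)
    from Compl.IH sp show ?case by eventually_elim simp
  next
    case (Union A)
    then have "AE \<omega> in M. \<forall>i. \<Phi> \<omega> \<in> A i \<longleftrightarrow> \<Psi> \<omega> \<in> A i" by (simp add: AE_all_countable)
    then show ?case by eventually_elim simp
  qed simp
  have all: "AE \<omega> in M. \<Phi> \<omega> \<in> B \<longleftrightarrow> \<Psi> \<omega> \<in> B" if B: "B \<in> sets N" for B
  proof -
    obtain A where A: "A \<in> family_sigma N T g" "emeasure N (sym_diff A B) = 0"
      using gen B unfolding generates_mod_null_def by blast
    have "family_sigma N T g \<subseteq> sets N" by (rule family_sigma_sets) (rule g)
    then have "A \<in> sets N" using A(1) by (rule subsetD)
    then have "sym_diff A B \<in> null_sets N" using A(2) B by auto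
    then have "AE \<omega> in M. \<Phi> \<omega> \<notin> sym_diff A B" "AE \<omega> in M. \<Psi> \<omega> \<notin> sym_diff A B"
      using \<Phi>(1) \<Psi>(1) unfolding nonsingular_map_def by blast+
    with family[OF A(1)] show ?thesis by eventually_elim blast
  qed
  obtain D :: "nat \<Rightarrow> _" where D: "\<And>n. D n \<in> sets N"
    and D_sep: "\<And>x x'. x \<in> space N \<Longrightarrow> x' \<in> space N \<Longrightarrow> \<forall>n. x \<in> D n \<longleftrightarrow> x' \<in> D n \<Longrightarrow> x = x'"
    using sep unfolding countably_separated_def by metis
  have "AE \<omega> in M. \<forall>n. \<Phi> \<omega> \<in> D n \<longleftrightarrow> \<Psi> \<omega> \<in> D n"
    using all[OF D] by (simp add: AE_all_countable)
  with sp show ?thesis by eventually_elim (rule D_sep)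
qed

section \<open>Mutually inverse maps give an isomorphism\<close>

text \<open>
  On the set \<open>E\<close> of fixed points of \<open>\<Psi> \<circ> \<Phi>\<close> and the set \<open>E'\<close> of fixed points of \<open>\<Phi> \<circ> \<Psi>\<close>, the maps
  are exactly inverse to each other: if \<open>\<Psi> (\<Phi> \<omega>) = \<omega>\<close>, then \<open>\<Phi> (\<Psi> (\<Phi> \<omega>)) = \<Phi> \<omega>\<close>, so \<open>\<Phi>\<close> maps
  \<open>E\<close> into \<open>E'\<close>, and symmetrically. Countable separation makes the two sets measurable. An image
  under \<open>\<Phi>\<close> is a preimage under \<open>\<Psi>\<close>, which gives its measure.
\<close>

lemma iso_mod_nullI:
  assumes \<Phi>: "\<Phi> \<in> M \<rightarrow>\<^sub>M N" and \<Psi>: "\<Psi> \<in> N \<rightarrow>\<^sub>M M" "M = distr N M \<Psi>"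
    and sep: "countably_separated M" "countably_separated N"
    and inv: "AE \<omega> in M. \<Psi> (\<Phi> \<omega>) = \<omega>" "AE \<omega> in N. \<Phi> (\<Psi> \<omega>) = \<omega>"
  shows "iso_mod_null M N \<Phi>"
proof -
  note [measurable] = \<Phi> \<Psi>(1)
  define E where "E = {\<omega> \<in> space M. \<Psi> (\<Phi> \<omega>) = \<omega>}"
  define E' where "E' = {\<omega> \<in> space N. \<Phi> (\<Psi> \<omega>) = \<omega>}"
  have E: "E \<in> sets M" unfolding E_def
    by (rule sets_Collect_eq_countably_separated[OF sep(1)]) measurable
  have E': "E' \<in> sets N" unfolding E'_def
    by (rule sets_Collect_eq_countably_separated[OF sep(2)]) measurable
  have null: "space M - E \<in> null_sets M"
  proof -
    have "{\<omega> \<in> space M. \<not> \<Psi> (\<Phi> \<omega>) = \<omega>} = space M - E" by (auto simp: E_def)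
    with inv(1) E show ?thesis by (simp add: AE_iff_null)
  qed
  have null': "space N - E' \<in> null_sets N"
  proof -
    have "{\<omega> \<in> space N. \<not> \<Phi> (\<Psi> \<omega>) = \<omega>} = space N - E'" by (auto simp: E'_def)
    with inv(2) E' show ?thesis by (simp add: AE_iff_null)
  qed
  have sub: "space M - (space M - E) = E" "space N - (space N - E') = E'"
    by (auto simp: E_def E'_def)
  have into: "\<Phi> \<omega> \<in> E'" if "\<omega> \<in> E" for \<omega>
    using that measurable_space[OF \<Phi>] by (auto simp: E_def E'_def)
  have into': "\<Psi> \<omega> \<in> E" if "\<omega> \<in> E'" for \<omega>
    using that measurable_space[OF \<Psi>(1)] by (auto simp: E_def E'_def)
  have bij: "bij_betw \<Phi> E E'"
    by (rule bij_betw_byWitness[of _ \<Psi>]) (use into into' in \<open>auto simp: E_def E'_def\<close>)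
  have inv_eq: "the_inv_into E \<Phi> \<omega> = \<Psi> \<omega>" if "\<omega> \<in> E'" for \<omega>
    using bij into'[OF that] that by (intro the_inv_into_f_eq) (auto simp: bij_betw_def E'_def)
  have sp: "space (restrict_space M E) = E" "space (restrict_space N E') = E'"
    by (auto simp: space_restrict_space E_def E'_def)
  have "\<Phi> \<in> restrict_space M E \<rightarrow>\<^sub>M restrict_space N E'"
    using into by (intro measurable_restrict_space3 \<Phi>) auto
  moreover have "\<Psi> \<in> restrict_space N E' \<rightarrow>\<^sub>M restrict_space M E"
    using into' by (intro measurable_restrict_space3 \<Psi>) auto
  then have "the_inv_into E \<Phi> \<in> restrict_space N E' \<rightarrow>\<^sub>M restrict_space M E"
    using inv_eq by (subst measurable_cong[where g = \<Psi>]) (auto simp: sp)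
  ultimately have "measurable_iso (restrict_space M E) (restrict_space N E') \<Phi>"
    using bij by (simp add: measurable_iso_def sp)
  moreover have "emeasure M B = emeasure N (\<Phi> ` B)" if B: "B \<in> sets M" "B \<subseteq> E" for B
  proof -
    have img: "\<Phi> ` B = \<Psi> -` B \<inter> space N \<inter> E'"
    proof (intro set_eqI iffI)
      fix \<omega> assume "\<omega> \<in> \<Phi> ` B"
      then show "\<omega> \<in> \<Psi> -` B \<inter> space N \<inter> E'"
        using B(2) into by (auto simp: E_def E'_def)
    next
      fix \<omega> assume "\<omega> \<in> \<Psi> -` B \<inter> space N \<inter> E'"
      then have "\<omega> = \<Phi> (\<Psi> \<omega>)" "\<Psi> \<omega> \<in> B" by (auto simp: E'_def)
      then show "\<omega> \<in> \<Phi> ` B" by (rule image_eqI)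
    qed
    have "emeasure M B = emeasure N (\<Psi> -` B \<inter> space N)"
      using emeasure_distr[OF \<Psi>(1) B(1)] \<Psi>(2) by simp
    also have "\<dots> = emeasure N (\<Psi> -` B \<inter> space N \<inter> E')"
      by (rule emeasure_eq_AE)
        (use inv(2) E' B(1) in \<open>auto simp: E'_def intro: measurable_sets[OF \<Psi>(1)]\<close>)
    finally show ?thesis by (simp add: img)
  qed
  ultimately show ?thesis
    unfolding iso_mod_null_def using null null' sub by metis
qed

text \<open>
  The inverse is obtained from the existence result with the roles of \<open>M\<close> and \<open>N\<close> exchanged, and
  uniqueness identifies both compositions with the identity. When \<open>M\<close> has no points, \<open>N\<close> may
  still have some and then no map from \<open>N\<close> to \<open>M\<close> exists; but \<open>N\<close> is then a null set of itself,
  and the empty bijection does.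
\<close>

lemma distr_intertwiner_iso_mod_null:
  fixes M :: "'a measure" and N :: "'b measure"
  assumes f: "\<And>t. t \<in> T \<Longrightarrow> f t \<in> borel_measurable M"
    and g: "\<And>t. t \<in> T \<Longrightarrow> g t \<in> borel_measurable N"
    and gen: "generates_mod_null M T f" "generates_mod_null N T g"
    and law: "distr M (\<Pi>\<^sub>M t\<in>T. borel) (joint_map T f) =
              distr N (\<Pi>\<^sub>M t\<in>T. borel) (joint_map T g)"
    and borel: "borel_space M" "borel_space N"
    and \<Phi>: "\<Phi> \<in> M \<rightarrow>\<^sub>M N" "N = distr M N \<Phi>" "intertwines T M f g \<Phi>"
  shows "iso_mod_null M N \<Phi>"
proof (cases "space M = {}")
  case True
  have null: "space N \<in> null_sets N"
    using emeasure_distr[OF \<Phi>(1), of "space N"] \<Phi>(2) True by auto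
  show ?thesis unfolding iso_mod_null_def
  proof (intro bexI conjI)
    show "measurable_iso (restrict_space M (space M - {})) (restrict_space N (space N - space N)) \<Phi>"
      using True by (simp add: measurable_iso_def space_restrict_space measurable_empty_iff bij_betw_def)
  qed (use null True in auto)
next
  case False
  obtain \<Psi> where \<Psi>: "\<Psi> \<in> N \<rightarrow>\<^sub>M M" "M = distr N M \<Psi>" "intertwines T N g f \<Psi>"
    using borel_space_intertwiner_exists[where M=N and N=M and f=g and g=f, OF g f gen(1) law False borel(1)]
    by metis
  note sep = borel_space_countably_separated[OF borel(1)] borel_space_countably_separated[OF borel(2)]
  note ns = nonsingular_map_distr[OF \<Phi>(1,2)] nonsingular_map_distr[OF \<Psi>(1,2)]
  have "AE \<omega> in M. \<Psi> (\<Phi> \<omega>) = \<omega>"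
    by (rule nonsingular_intertwiners_agree[OF f gen(1) sep(1) nonsingular_map_comp[OF ns]
          intertwines_comp[OF ns(1) \<Phi>(3) \<Psi>(3)] nonsingular_map_id intertwines_id])
  moreover have "AE \<omega> in N. \<Phi> (\<Psi> \<omega>) = \<omega>"
    by (rule nonsingular_intertwiners_agree[OF g gen(2) sep(2) nonsingular_map_comp[OF ns(2,1)]
          intertwines_comp[OF ns(2) \<Psi>(3) \<Phi>(3)] nonsingular_map_id intertwines_id])
  ultimately show ?thesis by (rule iso_mod_nullI[OF \<Phi>(1) \<Psi>(1,2) sep])
qed

theorem lemma5p1:
  fixes M1 :: "'a measure" and M2 :: "'b measure"
    and T :: "'t set"
    and f1 :: "'t \<Rightarrow> 'a \<Rightarrow> real" and f2 :: "'t \<Rightarrow> 'b \<Rightarrow> real"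
  assumes meas1: "\<And>t. t \<in> T \<Longrightarrow> f1 t \<in> borel_measurable M1"
    and meas2: "\<And>t. t \<in> T \<Longrightarrow> f2 t \<in> borel_measurable M2"
    and gen1: "generates_mod_null M1 T f1"
    and gen2: "generates_mod_null M2 T f2"
    and law: "distr M1 (\<Pi>\<^sub>M t\<in>T. borel) (joint_map T f1) =
              distr M2 (\<Pi>\<^sub>M t\<in>T. borel) (joint_map T f2)"
    and nonempty: "space M1 = {} \<Longrightarrow> space M2 = {}"
  shows
    "(borel_space M1 \<longrightarrow>
        (\<exists>\<Phi> \<in> M2 \<rightarrow>\<^sub>M M1. M1 = distr M2 M1 \<Phi> \<and> intertwines T M2 f2 f1 \<Phi>)) \<and>
     (borel_space M1 \<and> borel_space M2 \<longrightarrow>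
        (\<forall>\<Phi> \<in> M2 \<rightarrow>\<^sub>M M1. M1 = distr M2 M1 \<Phi> \<and> intertwines T M2 f2 f1 \<Phi> \<longrightarrow>
           iso_mod_null M2 M1 \<Phi> \<and>
           (\<forall>\<Psi> \<in> M2 \<rightarrow>\<^sub>M M1. M1 = distr M2 M1 \<Psi> \<and> intertwines T M2 f2 f1 \<Psi> \<longrightarrow>
              (AE \<omega> in M2. \<Phi> \<omega> = \<Psi> \<omega>)) \<and>
           (\<forall>\<Psi>. iso_mod_null M2 M1 \<Psi> \<and> intertwines T M2 f2 f1 \<Psi> \<longrightarrow>
              (AE \<omega> in M2. \<Phi> \<omega> = \<Psi> \<omega>))))"
proof (intro conjI impI)
  assume M1: "borel_space M1"
  show "\<exists>\<Phi> \<in> M2 \<rightarrow>\<^sub>M M1. M1 = distr M2 M1 \<Phi> \<and> intertwines T M2 f2 f1 \<Phi>"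
  proof (cases "space M1 = {}")
    case True
    then have M2: "space M2 = {}" by (rule nonempty)
    then have meas: "\<Phi> \<in> M2 \<rightarrow>\<^sub>M M1" for \<Phi> using True by (simp add: measurable_empty_iff)
    have "emeasure M1 A = emeasure (distr M2 M1 \<Phi>) A" if "A \<in> sets M1" for A \<Phi>
      using sets.sets_into_space[OF that] True by simp
    then have "M1 = distr M2 M1 \<Phi>" for \<Phi> by (intro measure_eqI) auto
    moreover have "intertwines T M2 f2 f1 \<Phi>" for \<Phi>
      unfolding intertwines_def using M2 by (auto intro: AE_I2)
    ultimately show ?thesis using meas by blast
  next
    case False
    then show ?thesis
      using borel_space_intertwiner_exists[where M=M2 and N=M1 and f=f2 and g=f1,
          OF meas2 meas1 gen1 law _ M1] by metis
  qed
next
  assume borel: "borel_space M1 \<and> borel_space M2"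
  note agree = nonsingular_intertwiners_agree[where M=M2 and N=M1 and f=f2 and g=f1,
      OF meas1 gen1 borel_space_countably_separated[OF borel[THEN conjunct1]]]
  show "\<forall>\<Phi> \<in> M2 \<rightarrow>\<^sub>M M1. M1 = distr M2 M1 \<Phi> \<and> intertwines T M2 f2 f1 \<Phi> \<longrightarrow>
     iso_mod_null M2 M1 \<Phi> \<and>
     (\<forall>\<Psi> \<in> M2 \<rightarrow>\<^sub>M M1. M1 = distr M2 M1 \<Psi> \<and> intertwines T M2 f2 f1 \<Psi> \<longrightarrow>
        (AE \<omega> in M2. \<Phi> \<omega> = \<Psi> \<omega>)) \<and>
     (\<forall>\<Psi>. iso_mod_null M2 M1 \<Psi> \<and> intertwines T M2 f2 f1 \<Psi> \<longrightarrow>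
        (AE \<omega> in M2. \<Phi> \<omega> = \<Psi> \<omega>))"
  proof (intro ballI impI conjI allI; elim conjE)
    fix \<Phi> assume \<Phi>: "\<Phi> \<in> M2 \<rightarrow>\<^sub>M M1" "M1 = distr M2 M1 \<Phi>" "intertwines T M2 f2 f1 \<Phi>"
    show "iso_mod_null M2 M1 \<Phi>"
      using borel by (intro distr_intertwiner_iso_mod_null[where f=f2 and g=f1, OF meas2 meas1 gen2 gen1 law[symmetric] _ _ \<Phi>]) auto
    note ns = nonsingular_map_distr[OF \<Phi>(1,2)]
    show "AE \<omega> in M2. \<Phi> \<omega> = \<Psi> \<omega>"
      if "\<Psi> \<in> M2 \<rightarrow>\<^sub>M M1" "M1 = distr M2 M1 \<Psi>" "intertwines T M2 f2 f1 \<Psi>" for \<Psi>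
      by (rule agree[OF _ ns \<Phi>(3) nonsingular_map_distr[OF that(1,2)] that(3)])
    show "AE \<omega> in M2. \<Phi> \<omega> = \<Psi> \<omega>"
      if "iso_mod_null M2 M1 \<Psi>" "intertwines T M2 f2 f1 \<Psi>" for \<Psi>
      by (rule agree[OF _ ns \<Phi>(3) nonsingular_map_iso_mod_null[OF that(1)] that(2)])
  qed
qed

end
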